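(* Let $s$ be an odd prime, let $p,q$ be integers with $3\le p\le q$, and let $n=p+q+1$. Then the following $(p+q)\times n$ matrix over $\mathrm{GF}(s)$, whose first $p$ rows form $\mathcal{G}_c$ and whose last $q$ rows form $\mathcal{G}_r$, yields a 2fi-optimal $s^{n-1}$ fractional factorial row-column design (in an $s^p\times s^q$ array): $$\mathcal{G}=\left(\begin{array}{cccc} I_p & J_p+H_p & \boldsymbol{a} & X_*\\ \hline H_p & J_p+2I_p & \boldsymbol{b} & \boldsymbol{0}_{p\times(q-p)}\\ \boldsymbol{0}_{(q-p)\times p} & \boldsymbol{0}_{(q-p)\times p} & \boldsymbol{0}_{(q-p)\times1} & I_{q-p}\end{array}\right),$$ where $\boldsymbol{a}=\boldsymbol{1}_p$, $\boldsymbol{b}=2\boldsymbol{a}+\boldsymbol{e}_1-\boldsymbol{e}_p$, and $X_*$ is a $p\times(q-p)$ matrix, with no zero column, selected so that each point of $\mathrm{PG}(p-1,s)$ appears among the columns of the $p\times n$ matrix $(I_p\;\;J_p+H_p\;\;\boldsymbol{a}\;\;X_* )$ either $\alpha$ or $\alpha+1$ times, where $\alpha=\lfloor n(s-1)/(s^p-1)\rfloor$.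
   Context: Matrices. $s$ is a prime and all matrices have entries in $\mathrm{GF}(s)=\mathbb{Z}/s$ (integers are reduced mod $s$). $I_v$ is the $v\times v$ identity, $J_v$ the $v\times v$ all-ones matrix, $\boldsymbol{1}_v$ the $v\times1$ all-ones vector, $\boldsymbol{0}_{v\times w}$ the zero matrix, $\boldsymbol{e}_i$ the column vector (here of length $p$) with $i$-th entry $1$ and other entries $0$, and $H_v=(h_{ij})$ the $v\times v$ matrix with $h_{ij}=1$ if $i+j=v+1$ and $h_{ij}=0$ otherwise. Blocks with zero rows or columns are omitted. $\mathrm{PG}(m-1,s)$ is the set of 1-dimensional subspaces ("points") of $\mathrm{GF}(s)^m$; a nonzero column vector belongs to (is an appearance of) the point it spans. Designs. Let $p,q\ge1$, $p+q\le n$. An array generator matrix is a $(p+q)\times n$ matrix $\mathcal{G}$ over $\mathrm{GF}(s)$ of full row rank $p+q$; $\mathcal{G}_c$ denotes its first $p$ rows, $\mathcal{G}_r$ its last $q$ rows, and $\mathcal{G}_i,\mathcal{G}_{c,i},\mathcal{G}_{r,i}$ the $i$-th columns of $\mathcal{G},\mathcal{G}_c,\mathcal{G}_r$. If $\boldsymbol{x}_1,\dots,\boldsymbol{x}_{s^p}$ are the vectors of the row space of $\mathcal{G}_c$ and $\boldsymbol{y}_1,\dots,\boldsymbol{y}_{s^q}$ those of the row space of $\mathcal{G}_r$ (with $\boldsymbol{x}_1=\boldsymbol{y}_1=0$), $\mathcal{G}$ yields the $s^p\times s^q$ row-column design whose cell $(i,j)$ carries the level combination $d[i,j]=\boldsymbol{x}_i+\boldsymbol{y}_j\in\mathrm{GF}(s)^n$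 of the $n$ factors $F_1,\dots,F_n$. It is an $s^n$ full factorial design when $p+q=n$, and an $s^{n-k}$ fractional factorial design when $p+q=n-k<n$. Model and confounding. $Y_{ij}=\mu+\tau_i+\rho_j+\gamma_{d[i,j]}+\varepsilon_{ij}$, with row effects $\tau_i$, column effects $\rho_j$, uncorrelated mean-zero errors of variance $\sigma^2$, and $\gamma_{(x_1,\dots,x_n)}=\sum_l\alpha_{l,x_l}+\sum_{l<m}\sum_{v=1}^{s-1}\beta^{(v)}_{lm,\,x_l+vx_m}$, where $\sum_u\alpha_{l,u}=0$ and $\sum_u\beta^{(v)}_{lm,u}=0$. A main effect $F_l$ is unconfounded if the estimators of the $\alpha_{l,u}$ are uncorrelated with all other estimators in the model; the two-factor interaction (2fi) $F_l\times F_m$ is unconfounded if for every $v=1,\dots,s-1$ the estimators of the $\beta^{(v)}_{lm,u}$ are uncorrelated with all other estimators in the model. Interactions of three or more factors are assumed negligible. Equivalent algebraic criterion (known result, Zhou and Zhou 2023), usable as the definition of confounding. A main effect or 2fi is confounded with another main effect or 2fi iff the columns of $\mathcal{G}$ corresponding to the (distinct) factors involved in the two effects are linearly dependent. If $\mathcal{G}_i\ne0$, $F_i$ is confounded with column effects iff $\mathcal{G}_{c,i}=0$, and with row effects iff $\mathcal{G}_{r,i}=0$. If $\mathcal{G}_i,\mathcal{G}_j$ are linearly independent, $F_i\times F_j$ is confounded with column effects iff $\mathcal{G}_{c,i},\mathcal{G}_{c,j}$ are linearly dependent, and with row effects iff $\mathcal{G}_{r,i},\mathcal{G}_{r,j}$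 are linearly dependent. An effect is unconfounded iff none of these confoundings occurs. 2fi-optimality. The design yielded by $\mathcal{G}$ is 2fi-optimal if all main effects are unconfounded and the number of unconfounded 2fi's is maximum among all designs yielded by array generator matrices with the same $(s,p,q,n)$ for which all main effects are unconfounded. *)

theory Defs
  imports
    "Berlekamp_Zassenhaus.Finite_Field"
    "Jordan_Normal_Form.DL_Rank"
begin

section \<open>Linear dependence of columns\<close>

text \<open>Dependence of the family of columns indexed by \<open>S\<close>. Two equal columns with different
  indices are dependent, so this is not dependence of the set of columns.\<close>

definition cols_dependent :: "'a::field mat \<Rightarrow> nat set \<Rightarrow> bool" where
  "cols_dependent A S \<longleftrightarrow>
     (\<exists>c. (\<exists>l\<in>S. c l \<noteq> 0) \<and> (\<forall>r<dim_row A. (\<Sum>l\<in>S. c l * A $$ (r, l)) = 0))"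

lemma cols_dependent_singleton:
  assumes "l < dim_col A"
  shows "cols_dependent A {l} \<longleftrightarrow> col A l = 0\<^sub>v (dim_row A)"
proof
  assume "cols_dependent A {l}"
  then show "col A l = 0\<^sub>v (dim_row A)"
    using assms by (auto simp: cols_dependent_def intro!: eq_vecI)
next
  assume "col A l = 0\<^sub>v (dim_row A)"
  then have "\<forall>r<dim_row A. A $$ (r, l) = 0"
    using assms by (metis index_col index_zero_vec(1))
  then show "cols_dependent A {l}"
    unfolding cols_dependent_def by (intro exI[of _ "\<lambda>_. 1"]) auto
qed

section \<open>Array generator matrices\<close>

text \<open>A matrix \<open>G\<close> with \<open>array_generator p q n G\<close> yields the row-column design with
  \<open>s\<^sup>p\<close> rows, labelled by the vectors \<open>x\<close> of the row space of \<open>col_part p G\<close>, and \<open>s\<^sup>q\<close> columns,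
  labelled by the vectors \<open>y\<close> of the row space of \<open>row_part p q G\<close>; the cell of \<open>x\<close> and \<open>y\<close>
  carries the level combination \<open>x + y\<close>. Factors are numbered from \<open>0\<close>, and factor \<open>i\<close> belongs
  to column \<open>i\<close> of \<open>G\<close>. The rank of \<open>G\<close> is the dimension of its column space, and it equals
  \<open>p + q\<close> iff \<open>G\<close> has full row rank.\<close>

definition array_generator :: "nat \<Rightarrow> nat \<Rightarrow> nat \<Rightarrow> 'a::field mat \<Rightarrow> bool" where
  "array_generator p q n G \<longleftrightarrow>
     1 \<le> p \<and> 1 \<le> q \<and> p + q \<le> n \<and>
     G \<in> carrier_mat (p + q) n \<and> vec_space.rank (p + q) G = p + q"

definition col_part :: "nat \<Rightarrow> 'a mat \<Rightarrow> 'a mat" where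
  "col_part p G = mat p (dim_col G) (\<lambda>(i, j). G $$ (i, j))"

definition row_part :: "nat \<Rightarrow> nat \<Rightarrow> 'a mat \<Rightarrow> 'a mat" where
  "row_part p q G = mat q (dim_col G) (\<lambda>(i, j). G $$ (p + i, j))"

section \<open>Confounding and optimality\<close>

text \<open>An effect is identified with its set of factors: \<open>{i}\<close> is the main effect of factor \<open>i\<close> and
  \<open>{i, j}\<close> is the two-factor interaction of \<open>i\<close> and \<open>j\<close>.\<close>

definition main_effects :: "nat \<Rightarrow> nat set set" where
  "main_effects n = {e. e \<subseteq> {..<n} \<and> card e = 1}"

definition two_factor_interactions :: "nat \<Rightarrow> nat set set" where
  "two_factor_interactions n = {e. e \<subseteq> {..<n} \<and> card e = 2}"

text \<open>Confounding is given by the criterion of Zhou and Zhou (2023) in terms of the columns of the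
  generator matrix, for the model with row effects, column effects, main effects and two-factor
  interactions.\<close>

definition confounded_with_effect :: "'a::field mat \<Rightarrow> nat set \<Rightarrow> nat set \<Rightarrow> bool" where
  "confounded_with_effect G e f \<longleftrightarrow> e \<noteq> f \<and> cols_dependent G (e \<union> f)"

text \<open>For a main effect \<open>{i}\<close> the next two conditions say that column \<open>i\<close> of the respective part
  of \<open>G\<close> is zero (\<open>cols_dependent_singleton\<close>). The criterion states them only if the columns
  of \<open>G\<close> indexed by \<open>e\<close> are independent; otherwise \<open>e\<close> is already confounded with another
  effect.\<close>

definition confounded_with_columns :: "nat \<Rightarrow> 'a::field mat \<Rightarrow> nat set \<Rightarrow> bool" where
  "confounded_with_columns p G e \<longleftrightarrow> cols_dependent (col_part p G) e"

definition confounded_with_rows :: "nat \<Rightarrow> nat \<Rightarrow> 'a::field mat \<Rightarrow> nat set \<Rightarrow> bool" where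
  "confounded_with_rows p q G e \<longleftrightarrow> cols_dependent (row_part p q G) e"

definition unconfounded :: "nat \<Rightarrow> nat \<Rightarrow> nat \<Rightarrow> 'a::field mat \<Rightarrow> nat set \<Rightarrow> bool" where
  "unconfounded p q n G e \<longleftrightarrow>
     (\<forall>f \<in> main_effects n \<union> two_factor_interactions n. \<not> confounded_with_effect G e f) \<and>
     \<not> confounded_with_columns p G e \<and>
     \<not> confounded_with_rows p q G e"

definition main_effects_unconfounded :: "nat \<Rightarrow> nat \<Rightarrow> nat \<Rightarrow> 'a::field mat \<Rightarrow> bool" where
  "main_effects_unconfounded p q n G \<longleftrightarrow> (\<forall>e \<in> main_effects n. unconfounded p q n G e)"

definition num_unconfounded_2fi :: "nat \<Rightarrow> nat \<Rightarrow> nat \<Rightarrow> 'a::field mat \<Rightarrow> nat" where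
  "num_unconfounded_2fi p q n G = card {e \<in> two_factor_interactions n. unconfounded p q n G e}"

text \<open>The field, and with it \<open>s\<close>, is fixed by the type of the matrix.\<close>

definition yields_2fi_optimal :: "nat \<Rightarrow> nat \<Rightarrow> nat \<Rightarrow> 'a::field mat \<Rightarrow> bool" where
  "yields_2fi_optimal p q n G \<longleftrightarrow>
     array_generator p q n G \<and> main_effects_unconfounded p q n G \<and>
     (\<forall>G' :: 'a mat. array_generator p q n G' \<and> main_effects_unconfounded p q n G' \<longrightarrow>
        num_unconfounded_2fi p q n G' \<le> num_unconfounded_2fi p q n G)"

section \<open>Points of the projective space\<close>

definition pg_points :: "nat \<Rightarrow> 'a::field vec set set" where
  "pg_points m =
     {W. VectorSpace.subspace class_ring W (module_vec TYPE('a) m) \<and>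
         vectorspace.dim class_ring ((module_vec TYPE('a) m)\<lparr>carrier := W\<rparr>) = 1}"

lemma pg_points_eq:
  "pg_points m = {range (\<lambda>c. c \<cdot>\<^sub>v v) | v :: 'a::{field,finite} vec. v \<in> carrier_vec m \<and> v \<noteq> 0\<^sub>v m}"
proof -
  interpret vec_space "TYPE('a)" m .
  have span1: "span {v} = range (\<lambda>c. c \<cdot>\<^sub>v v)" if v: "v \<in> carrier_vec m" for v
  proof -
    have "span {v} = {lincomb a {v} | a. True}"
      using finite_span[of "{v}"] v by auto
    moreover have "lincomb a {v} = a v \<cdot>\<^sub>v v" for a
      using v by (simp add: lincomb_def)
    ultimately show ?thesis by (auto simp: image_def)
  qed
  have li: "lin_indpt {v}" if v: "v \<in> carrier_vec m" "v \<noteq> 0\<^sub>v m" for v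
  proof -
    have "lincomb a {v} = 0\<^sub>v m \<longrightarrow> a v = 0" for a
    proof
      assume "lincomb a {v} = 0\<^sub>v m"
      then have "a v \<cdot>\<^sub>v v = 0\<^sub>v m" using v by (simp add: lincomb_def)
      then show "a v = 0"
        using v by (metis carrier_vecD eq_vecI index_smult_vec(1) index_zero_vec mult_eq_0_iff)
    qed
    then show ?thesis using v
      by (intro finite_lin_indpt2) auto
  qed
  show ?thesis
  proof (intro equalityI subsetI)
    fix W :: "'a vec set" assume "W \<in> pg_points m"
    then have sub: "VectorSpace.subspace class_ring W V"
      and d: "vectorspace.dim class_ring (vs W) = 1" by (auto simp: pg_points_def)
    then have vsW: "vectorspace class_ring (vs W)" by (rule_tac subspace_is_vs)
    from sub have sm: "submodule class_ring W V" by simp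
    then have WC: "W \<subseteq> carrier_vec m" using submodule.subset[OF sm] by simp
    have "vectorspace.fin_dim class_ring (vs W)"
    proof -
      have "W \<subseteq> vec_of_list ` {xs. set xs \<subseteq> UNIV \<and> length xs = m}"
        using WC by (metis (mono_tags, lifting) carrier_vecD image_eqI length_list_of_vec mem_Collect_eq subsetD subsetI subset_UNIV vec_list)
      moreover have "finite {xs :: 'a list. set xs \<subseteq> UNIV \<and> length xs = m}"
        by (rule finite_lists_length_eq) simp
      ultimately have "finite W" using finite_surj by blast
      moreover have "LinearCombinations.module.span class_ring (vs W) W = W"
        using span_li_not_depend(1)[OF subset_refl sm] span_is_subset[OF subset_refl sm] in_own_span[of W] WC by simp
      ultimately show ?thesis unfolding vectorspace.fin_dim_def[OF vsW] by auto
    qed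
    then obtain B where B: "finite B" "vectorspace.basis class_ring (vs W) B"
      using vectorspace.finite_basis_exists[OF vsW] by blast
    then have "card B = 1" using vectorspace.dim_basis[OF vsW B] d by simp
    then obtain v where Bv: "B = {v}" by (auto simp: card_1_singleton_iff)
    from B(2) have BW: "B \<subseteq> W" and g: "LinearCombinations.module.span class_ring (vs W) B = W"
      and l: "LinearCombinations.module.lin_indpt class_ring (vs W) B"
      unfolding vectorspace.basis_def[OF vsW] by auto
    have "span B = W" "lin_indpt B"
      using span_li_not_depend[OF BW sm] g l by auto
    moreover have vC: "v \<in> carrier_vec m" using BW WC Bv by auto
    moreover have "(UNIV :: 'a set) \<noteq> {0}" by (metis UNIV_I singletonD zero_neq_one)
    ultimately have "W = range (\<lambda>c. c \<cdot>\<^sub>v v)" "v \<noteq> 0\<^sub>v m"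
      using span1[OF vC] Bv zero_nin_lin_indpt[of B] by auto
    then show "W \<in> {range (\<lambda>c. c \<cdot>\<^sub>v v) | v. v \<in> carrier_vec m \<and> v \<noteq> 0\<^sub>v m}"
      using vC by auto
  next
    fix W assume "W \<in> {range (\<lambda>c. c \<cdot>\<^sub>v v) | v :: 'a vec. v \<in> carrier_vec m \<and> v \<noteq> 0\<^sub>v m}"
    then obtain v where v: "v \<in> carrier_vec m" "v \<noteq> 0\<^sub>v m" and W: "W = span {v}"
      using span1 by auto
    have sub: "VectorSpace.subspace class_ring W V"
      unfolding W using v by (intro span_is_subspace) auto
    have "vectorspace.dim class_ring (vs W) = card {v}"
      unfolding W using v li[OF v] by (intro dim_span) (auto simp: maximal_def)
    then show "W \<in> pg_points m" using sub by (simp add: pg_points_def)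
  qed
qed

definition appearances :: "'a::field mat \<Rightarrow> 'a vec set \<Rightarrow> nat" where
  "appearances A W =
     card {j. j < dim_col A \<and> col A j \<noteq> 0\<^sub>v (dim_row A) \<and> col A j \<in> W}"

section \<open>Block matrices\<close>

definition append_cols :: "'a::zero mat \<Rightarrow> 'a mat \<Rightarrow> 'a mat" (infixr \<open>@\<^sub>c\<close> 70) where
  "A @\<^sub>c B = four_block_mat A B (0\<^sub>m 0 (dim_col A)) (0\<^sub>m 0 (dim_col B))"

definition col_mat :: "'a vec \<Rightarrow> 'a mat" where
  "col_mat v = mat_of_cols (dim_vec v) [v]"

definition ones_vec :: "nat \<Rightarrow> 'a::one vec" where
  "ones_vec v = vec v (\<lambda>_. 1)"

definition ones_mat :: "nat \<Rightarrow> 'a::one mat" where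
  "ones_mat v = mat v v (\<lambda>_. 1)"

text \<open>With indices starting from \<open>0\<close>, the condition \<open>i + j = v + 1\<close> becomes \<open>i + j + 1 = v\<close>.\<close>

definition exchange_mat :: "nat \<Rightarrow> 'a::{zero,one} mat" where
  "exchange_mat v = mat v v (\<lambda>(i, j). if i + j + 1 = v then 1 else 0)"

end

theory Submission
  imports Defs
begin

text \<open>
  If all main effects of a design are unconfounded, then every column of the column part of its
  generator matrix is nonzero and is an appearance of exactly one point of the projective space
  \<open>PG(p - 1, s)\<close>. Two factors whose columns appear on the same point have an interaction that is
  confounded with column effects, so a design in which point \<open>P\<close> appears \<open>m P\<close> times has at least
  \<open>\<Sum>P. m P choose 2\<close> confounded interactions. The numbers \<open>m P\<close> add up to \<open>n\<close>, and by convexity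
  of \<open>m choose 2\<close> the bound is smallest when they take only two consecutive values
  (\<open>dependent_pairs_minimal_if_balanced\<close>). The hypothesis on \<open>X\<close> says just this.

  What remains is that the given matrix \<open>G\<close> loses no interaction in any other way
  (\<open>optimal_if_balanced\<close>). It has one column more than rows, and solving for its kernel block by
  block shows that up to scalars there is a single dependence among its columns
  (\<open>kernel_vector\<close>). This dependence involves at least five columns, so any four columns are
  independent (\<open>four_columns_independent\<close>) and no two effects are confounded with each other. In the
  row part any two columns are independent (\<open>row_part_pair_independent\<close>), so nothing is confounded
  with row effects. Both facts rest on \<open>p \<ge> 3\<close> and on \<open>2\<close> being invertible, as \<open>s\<close> is odd.
\<close>

section \<open>Dependent families of columns\<close>

lemma cols_dependent_mono:
  assumes "cols_dependent A S" and "S \<subseteq> T" and "finite T"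
  shows "cols_dependent A T"
proof -
  obtain c where c: "\<exists>l\<in>S. c l \<noteq> 0" "\<forall>r<dim_row A. (\<Sum>l\<in>S. c l * A $$ (r, l)) = 0"
    using assms(1) unfolding cols_dependent_def by blast
  let ?c = "\<lambda>l. if l \<in> S then c l else 0"
  have "(\<Sum>l\<in>T. ?c l * A $$ (r, l)) = (\<Sum>l\<in>S. c l * A $$ (r, l))" for r
    using assms(2,3) by (intro sum.mono_neutral_cong_right) auto
  then show ?thesis
    unfolding cols_dependent_def using c assms(2) by (intro exI[of _ ?c]) auto
qed

text \<open>Extending the coefficients by \<open>0\<close> turns a dependence of some columns into a vector of the kernel
  of the whole matrix, supported on those columns. In this form all dependences can be read off one
  and the same system of linear equations.\<close>

lemma cols_dependent_coefficients:
  assumes "cols_dependent A S" and "S \<subseteq> {..<n}"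
  obtains c where "\<exists>l<n. c l \<noteq> 0" and "\<And>l. l \<notin> S \<Longrightarrow> c l = 0"
    and "\<And>r. r < dim_row A \<Longrightarrow> (\<Sum>l<n. c l * A $$ (r, l)) = 0"
proof -
  obtain c where c: "\<exists>l\<in>S. c l \<noteq> 0" "\<forall>r<dim_row A. (\<Sum>l\<in>S. c l * A $$ (r, l)) = 0"
    using assms(1) unfolding cols_dependent_def by blast
  let ?c = "\<lambda>l. if l \<in> S then c l else 0"
  have "(\<Sum>l<n. ?c l * A $$ (r, l)) = (\<Sum>l\<in>S. c l * A $$ (r, l))" for r
    using assms(2) by (intro sum.mono_neutral_cong_right) auto
  then show thesis
    using c assms(2) by (intro that[of ?c]) auto
qed

lemma rank_eq_dim_row:
  fixes A :: "'a::field mat"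
  assumes A: "A \<in> carrier_mat m n" and S: "S \<subseteq> {..<n}" "card S = m"
    and indep: "\<not> cols_dependent A S"
  shows "vec_space.rank m A = m"
proof -
  interpret vec_space "TYPE('a)" m .
  let ?U = "col A ` S"
  have fin: "finite S" using S(1) finite_subset by blast
  have sub: "?U \<subseteq> set (cols A)" using S(1) A by (auto simp: cols_def)
  have carr: "set (cols A) \<subseteq> carrier_vec m" using cols_dim A by blast
  have inj: "inj_on (col A) S"
  proof (rule inj_onI, rule ccontr)
    fix i j assume ij: "i \<in> S" "j \<in> S" "col A i = col A j" "i \<noteq> j"
    have "A $$ (r, i) = A $$ (r, j)" if "r < m" for r
      using ij S(1) A that by (metis carrier_matD index_col lessThan_iff subsetD)
    then have "cols_dependent A {i, j}"
      unfolding cols_dependent_def using ij A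
      by (intro exI[of _ "\<lambda>l. if l = i then 1 else - 1"]) auto
    then show False
      using indep cols_dependent_mono[of A "{i, j}" S] ij fin by auto
  qed
  have "lin_indpt ?U"
  proof (rule finite_lin_indpt2)
    show "finite ?U" using fin by simp
    show "?U \<subseteq> carrier_vec m" using sub carr by auto
    fix a :: "'a vec \<Rightarrow> 'a" assume l: "lincomb a ?U = 0\<^sub>v m"
    have "(\<Sum>i\<in>S. a (col A i) * A $$ (r, i)) = 0" if r: "r < m" for r
    proof -
      have "(\<Sum>x\<in>?U. a x * x $ r) = lincomb a ?U $ r"
        using lincomb_index[OF r, of ?U a] sub carr by auto
      also have "\<dots> = 0" using l r by simp
      finally have "(\<Sum>i\<in>S. a (col A i) * col A i $ r) = 0"
        by (simp add: sum.reindex[OF inj])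
      moreover have "(\<Sum>i\<in>S. a (col A i) * col A i $ r) = (\<Sum>i\<in>S. a (col A i) * A $$ (r, i))"
        using S(1) A r by (intro sum.cong) auto
      ultimately show ?thesis by simp
    qed
    then have "\<not> (\<exists>i\<in>S. a (col A i) \<noteq> 0)"
      using indep A unfolding cols_dependent_def by (metis carrier_matD(1))
    then show "\<forall>v\<in>?U. a v = 0" by auto
  qed
  then have "m \<le> rank A"
    using rank_ge_card_indpt[OF A sub] card_image[OF inj] S(2) by simp
  moreover have "rank A \<le> m"
  proof -
    obtain T where T: "maximal T (\<lambda>T. T \<subseteq> set (cols A) \<and> lin_indpt T)"
      using maximal_exists_superset[of "set (cols A)" "\<lambda>T. T \<subseteq> set (cols A) \<and> lin_indpt T" ?U]
        sub \<open>lin_indpt ?U\<close> by auto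
    then have "T \<subseteq> carrier_vec m" "lin_indpt T" using carr by (auto simp: maximal_def)
    then have "card T \<le> m" using li_le_dim(2)[of T] dim_is_n by simp
    then show ?thesis using rank_card_indpt[OF A T] by simp
  qed
  ultimately show ?thesis by simp
qed

section \<open>Pairs of columns on a common point\<close>

lemma pg_point_unique:
  fixes v :: "'a::{field,finite} vec"
  assumes P: "P \<in> pg_points m" "v \<in> P" and v: "v \<noteq> 0\<^sub>v m"
  shows "P = range (\<lambda>c. c \<cdot>\<^sub>v v)"
proof -
  obtain w :: "'a vec" and a where w: "w \<in> carrier_vec m" "P = range (\<lambda>c. c \<cdot>\<^sub>v w)" "v = a \<cdot>\<^sub>v w"
    using P unfolding pg_points_eq by blast
  have a: "a \<noteq> 0" using v w by auto
  have "c \<cdot>\<^sub>v w = (c / a) \<cdot>\<^sub>v v" for c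
    using a by (simp add: w(3) smult_smult_assoc)
  then have "range (\<lambda>c. c \<cdot>\<^sub>v w) \<subseteq> range (\<lambda>c. c \<cdot>\<^sub>v v)" by blast
  moreover have "c \<cdot>\<^sub>v v = (c * a) \<cdot>\<^sub>v w" for c
    by (simp add: w(3) smult_smult_assoc)
  then have "range (\<lambda>c. c \<cdot>\<^sub>v v) \<subseteq> range (\<lambda>c. c \<cdot>\<^sub>v w)" by blast
  ultimately show ?thesis using w(2) by blast
qed

lemma range_smult_in_pg_points:
  fixes v :: "'a::{field,finite} vec"
  assumes "v \<in> carrier_vec m" "v \<noteq> 0\<^sub>v m"
  shows "range (\<lambda>c. c \<cdot>\<^sub>v v) \<in> pg_points m" "v \<in> range (\<lambda>c. c \<cdot>\<^sub>v v)"
proof -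
  show "range (\<lambda>c. c \<cdot>\<^sub>v v) \<in> pg_points m" using assms unfolding pg_points_eq by blast
  show "v \<in> range (\<lambda>c. c \<cdot>\<^sub>v v)" by (rule range_eqI[of _ _ 1]) simp
qed

text \<open>This translates confounding with column effects into projective geometry: nonzero columns are
  proportional iff they are appearances of the same point.\<close>

lemma cols_dependent_pair_iff_common_point:
  fixes A :: "'a::{field,finite} mat"
  assumes A: "A \<in> carrier_mat m n" and ij: "i < n" "j < n" "i \<noteq> j"
    and nz: "col A i \<noteq> 0\<^sub>v m" "col A j \<noteq> 0\<^sub>v m"
  shows "cols_dependent A {i, j} \<longleftrightarrow> (\<exists>P\<in>pg_points m. col A i \<in> P \<and> col A j \<in> P)"
proof
  assume "cols_dependent A {i, j}"
  then obtain c where c: "c i \<noteq> 0 \<or> c j \<noteq> 0"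
    and eq: "\<And>r. r < m \<Longrightarrow> c i * A $$ (r, i) + c j * A $$ (r, j) = 0"
    unfolding cols_dependent_def using A ij by auto
  have "c i \<noteq> 0"
  proof
    assume "c i = 0"
    then have "A $$ (r, j) = 0" if "r < m" for r using c eq[OF that] by simp
    then have "col A j = 0\<^sub>v m" using A ij by (intro eq_vecI) auto
    then show False using nz by simp
  qed
  have "A $$ (r, i) = - c j / c i * A $$ (r, j)" if "r < m" for r
    using eq[OF that] \<open>c i \<noteq> 0\<close> by (simp add: field_simps eq_neg_iff_add_eq_0)
  then have "col A i = (- c j / c i) \<cdot>\<^sub>v col A j"
    using A ij by (intro eq_vecI) auto
  moreover have "col A j \<in> carrier_vec m" using A by auto
  ultimately show "\<exists>P\<in>pg_points m. col A i \<in> P \<and> col A j \<in> P"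
    using range_smult_in_pg_points[of "col A j" m] nz(2)
    by (intro bexI[of _ "range (\<lambda>c. c \<cdot>\<^sub>v col A j)"] conjI) (auto intro: range_eqI)
next
  assume "\<exists>P\<in>pg_points m. col A i \<in> P \<and> col A j \<in> P"
  then have "col A i \<in> range (\<lambda>c. c \<cdot>\<^sub>v col A j)"
    using pg_point_unique nz(2) by blast
  then obtain a where a: "col A i = a \<cdot>\<^sub>v col A j" by blast
  have "A $$ (r, i) = a * A $$ (r, j)" if "r < m" for r
  proof -
    have "col A i $ r = a * col A j $ r" unfolding a using A that by simp
    then show ?thesis using A ij that by simp
  qed
  then show "cols_dependent A {i, j}"
    unfolding cols_dependent_def using A ij
    by (intro exI[of _ "\<lambda>l. if l = i then 1 else - a"]) auto
qed

lemma finite_pg_points: "finite (pg_points m :: 'a::{field,finite} vec set set)"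
proof -
  have "(carrier_vec m :: 'a vec set) \<subseteq> vec_of_list ` {xs. set xs \<subseteq> UNIV \<and> length xs = m}"
    by (metis (mono_tags, lifting) carrier_vecD image_eqI length_list_of_vec mem_Collect_eq
        subsetI subset_UNIV vec_list)
  then have "finite (carrier_vec m :: 'a vec set)"
    using finite_lists_length_eq[of "UNIV :: 'a set" m] by (auto intro: finite_subset)
  moreover have "pg_points m = (\<lambda>v :: 'a vec. range (\<lambda>c. c \<cdot>\<^sub>v v)) ` {v \<in> carrier_vec m. v \<noteq> 0\<^sub>v m}"
    unfolding pg_points_eq by auto
  ultimately show ?thesis by simp
qed

lemma sum_appearances:
  fixes A :: "'a::{field,finite} mat"
  assumes A: "A \<in> carrier_mat m n" and nz: "\<And>l. l < n \<Longrightarrow> col A l \<noteq> 0\<^sub>v m"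
  shows "(\<Sum>P\<in>pg_points m. appearances A P) = n"
proof -
  let ?J = "\<lambda>P. {j. j < dim_col A \<and> col A j \<noteq> 0\<^sub>v (dim_row A) \<and> col A j \<in> P}"
  have "(\<Union>P\<in>pg_points m. ?J P) = {..<n}"
  proof (intro equalityI subsetI)
    fix j assume "j \<in> {..<n}"
    moreover have "col A j \<in> carrier_vec m" using A by auto
    ultimately show "j \<in> (\<Union>P\<in>pg_points m. ?J P)"
      using range_smult_in_pg_points[of "col A j" m] nz[of j] A by blast
  qed (use A in auto)
  moreover have "card (\<Union>P\<in>pg_points m. ?J P) = (\<Sum>P\<in>pg_points m. card (?J P))"
  proof (rule card_UN_disjoint)
    show "\<forall>P\<in>pg_points m. \<forall>Q\<in>pg_points m. P \<noteq> Q \<longrightarrow> ?J P \<inter> ?J Q = {}"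
      using A pg_point_unique by (smt (verit) carrier_matD(1) disjoint_iff mem_Collect_eq)
  qed (auto simp: finite_pg_points)
  ultimately show ?thesis by (simp add: appearances_def)
qed

text \<open>Proportionality is an equivalence relation on nonzero columns with the points as classes, so the
  proportional pairs are counted class by class.\<close>

lemma card_dependent_pairs:
  fixes A :: "'a::{field,finite} mat"
  assumes A: "A \<in> carrier_mat m n" and nz: "\<And>l. l < n \<Longrightarrow> col A l \<noteq> 0\<^sub>v m"
  shows "card {e \<in> two_factor_interactions n. cols_dependent A e} =
    (\<Sum>P\<in>pg_points m. appearances A P choose 2)"
proof -
  let ?J = "\<lambda>P. {j. j < dim_col A \<and> col A j \<noteq> 0\<^sub>v (dim_row A) \<and> col A j \<in> P}"
  let ?E = "\<lambda>P. {e. e \<subseteq> ?J P \<and> card e = 2}"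
  have "{e \<in> two_factor_interactions n. cols_dependent A e} = (\<Union>P\<in>pg_points m. ?E P)"
  proof (intro equalityI subsetI)
    fix e assume e: "e \<in> {e \<in> two_factor_interactions n. cols_dependent A e}"
    then obtain i j where ij: "e = {i, j}" "i \<noteq> j" "i < n" "j < n"
      unfolding two_factor_interactions_def card_2_iff by auto
    then obtain P where "P \<in> pg_points m" "col A i \<in> P" "col A j \<in> P"
      using e cols_dependent_pair_iff_common_point[OF A] nz by blast
    then show "e \<in> (\<Union>P\<in>pg_points m. ?E P)" using ij nz A by auto
  next
    fix e assume "e \<in> (\<Union>P\<in>pg_points m. ?E P)"
    then obtain P where P: "P \<in> pg_points m" "e \<subseteq> ?J P" "card e = 2" by blast
    then obtain i j where ij: "e = {i, j}" "i \<noteq> j" unfolding card_2_iff by auto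
    then have "i < n" "j < n" "col A i \<in> P" "col A j \<in> P" using P A by auto
    then have "cols_dependent A e"
      using cols_dependent_pair_iff_common_point[OF A] nz ij P(1) by blast
    then show "e \<in> {e \<in> two_factor_interactions n. cols_dependent A e}"
      using P ij \<open>i < n\<close> \<open>j < n\<close> by (auto simp: two_factor_interactions_def)
  qed
  moreover have "card (\<Union>P\<in>pg_points m. ?E P) = (\<Sum>P\<in>pg_points m. card (?E P))"
  proof (rule card_UN_disjoint)
    have "?E P \<subseteq> Pow {..<n}" for P using A by auto
    then show "\<forall>P\<in>pg_points m. finite (?E P)"
      by (meson finite_Pow_iff finite_lessThan finite_subset)
    have "P = Q" if "P \<in> pg_points m" "Q \<in> pg_points m" and e: "e \<in> ?E P" "e \<in> ?E Q" for P Q e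
    proof -
      obtain j where "j \<in> e" using e by (metis (mono_tags, lifting) card.empty equals0I mem_Collect_eq zero_neq_numeral)
      then have "col A j \<noteq> 0\<^sub>v m" "col A j \<in> P" "col A j \<in> Q" using e A by auto
      then show ?thesis using that(1,2) pg_point_unique by metis
    qed
    then show "\<forall>P\<in>pg_points m. \<forall>Q\<in>pg_points m. P \<noteq> Q \<longrightarrow> ?E P \<inter> ?E Q = {}" by blast
  qed (rule finite_pg_points)
  ultimately show ?thesis by (simp add: appearances_def n_subsets)
qed

lemma two_choose_two: "2 * (m choose 2) + m = m * m"
  by (induction m) (auto simp: numeral_2_eq_2)

text \<open>Convexity of \<open>m choose 2\<close> in discrete form: the line of slope \<open>k\<close> through the values at \<open>k\<close> and
  \<open>k + 1\<close> supports the graph, because twice the difference is \<open>(m - k) * (m - k - 1)\<close>, a product of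
  consecutive integers.\<close>

lemma choose_two_tangent:
  "k * m \<le> (m choose 2) + (k + 1 choose 2)"
  "m = k \<or> m = k + 1 \<Longrightarrow> k * m = (m choose 2) + (k + 1 choose 2)"
proof -
  define u where "u = (m choose 2) + (k + 1 choose 2)"
  define d where "d = int m - int k"
  define t where "t = d * (d - 1)"
  have sq: "2 * int (m choose 2) + int m = int m * int m" for m
    using arg_cong[OF two_choose_two[of m], of int] by simp
  have "2 * int (m choose 2) = int m * int m - int m"
    using sq[of m] by linarith
  moreover have "2 * int (k + 1 choose 2) = (int k + 1) * (int k + 1) - (int k + 1)"
    using sq[of "k + 1"] by (metis add_diff_cancel_right' of_nat_1 of_nat_add)
  moreover have "2 * int (k * m) + t
    = (int m * int m - int m) + ((int k + 1) * (int k + 1) - (int k + 1))"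
    unfolding t_def d_def by (simp add: algebra_simps)
  ultimately have double: "2 * int u = 2 * int (k * m) + t"
    unfolding u_def of_nat_add by (simp only: distrib_left)
  have "0 \<le> t"
    unfolding t_def by (cases "d \<le> 0") (auto simp: mult_nonpos_nonpos)
  with double have "int (k * m) \<le> int u" by linarith
  then show "k * m \<le> (m choose 2) + (k + 1 choose 2)"
    by (simp only: of_nat_le_iff u_def)
  assume "m = k \<or> m = k + 1"
  then have "t = 0" by (auto simp: t_def d_def)
  with double have "int (k * m) = int u" by linarith
  then show "k * m = (m choose 2) + (k + 1 choose 2)"
    by (simp only: of_nat_eq_iff u_def)
qed

text \<open>The supporting line at \<open>k\<close>, summed over all points, bounds the number of pairs from below
  in terms of \<open>k\<close> and the number of columns only; a balanced matrix attains the bound.\<close>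

lemma dependent_pairs_minimal_if_balanced:
  fixes A B :: "'a::{field,finite} mat"
  assumes A: "A \<in> carrier_mat m n" "\<And>l. l < n \<Longrightarrow> col A l \<noteq> 0\<^sub>v m"
    and B: "B \<in> carrier_mat m n" "\<And>l. l < n \<Longrightarrow> col B l \<noteq> 0\<^sub>v m"
    and bal: "\<And>P. P \<in> pg_points m \<Longrightarrow> appearances A P = k \<or> appearances A P = k + 1"
  shows "card {e \<in> two_factor_interactions n. cols_dependent A e}
    \<le> card {e \<in> two_factor_interactions n. cols_dependent B e}"
proof -
  let ?N = "card (pg_points m :: 'a vec set set) * (k + 1 choose 2)"
  have "(\<Sum>P\<in>pg_points m. appearances A P choose 2) + ?N
    = (\<Sum>P\<in>pg_points m. (appearances A P choose 2) + (k + 1 choose 2))"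
    by (simp add: sum.distrib)
  also have "\<dots> = (\<Sum>P\<in>pg_points m. k * appearances A P)"
    by (intro sum.cong refl choose_two_tangent(2)[symmetric] bal)
  also have "\<dots> = (\<Sum>P\<in>pg_points m. k * appearances B P)"
    by (simp flip: sum_distrib_left add: sum_appearances[OF A] sum_appearances[OF B])
  also have "\<dots> \<le> (\<Sum>P\<in>pg_points m. (appearances B P choose 2) + (k + 1 choose 2))"
    by (intro sum_mono choose_two_tangent(1))
  also have "\<dots> = (\<Sum>P\<in>pg_points m. appearances B P choose 2) + ?N"
    by (simp add: sum.distrib)
  finally show ?thesis
    using card_dependent_pairs[OF A] card_dependent_pairs[OF B] by simp
qed

section \<open>A criterion for optimality\<close>

text \<open>For every competitor the pairs that are proportional in the column part are confounded. Under the
  conditions on \<open>G\<close> these are the only confounded pairs, and balance makes their number minimal. Four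
  columns are what two interactions without a common factor involve.\<close>

theorem optimal_if_balanced:
  fixes G :: "'a::{field,finite} mat"
  assumes gen: "array_generator p q n G"
    and indep: "\<And>S. S \<subseteq> {..<n} \<Longrightarrow> card S \<le> 4 \<Longrightarrow> \<not> cols_dependent G S"
    and nz: "\<And>l. l < n \<Longrightarrow> col (col_part p G) l \<noteq> 0\<^sub>v p"
    and rows: "\<And>e. e \<in> two_factor_interactions n \<Longrightarrow> \<not> cols_dependent (row_part p q G) e"
    and bal: "\<And>P. P \<in> pg_points p \<Longrightarrow>
      appearances (col_part p G) P = k \<or> appearances (col_part p G) P = k + 1"
  shows "yields_2fi_optimal p q n G"
proof -
  have part: "col_part p G' \<in> carrier_mat p n" if "array_generator p q n G'" for G' :: "'a mat"
    using that unfolding array_generator_def col_part_def by auto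
  have n2: "2 \<le> n" using gen unfolding array_generator_def by linarith
  have fin: "finite (two_factor_interactions n)"
    unfolding two_factor_interactions_def by (rule finite_subset[of _ "Pow {..<n}"]) auto
  have eff: "\<not> confounded_with_effect G e f"
    if ef: "e \<in> main_effects n \<union> two_factor_interactions n"
      "f \<in> main_effects n \<union> two_factor_interactions n" for e f
  proof -
    have "e \<union> f \<subseteq> {..<n}" "card e \<le> 2" "card f \<le> 2"
      using ef unfolding main_effects_def two_factor_interactions_def by auto
    moreover have "card (e \<union> f) \<le> card e + card f" by (rule card_Un_le)
    ultimately show ?thesis using indep[of "e \<union> f"] unfolding confounded_with_effect_def by simp
  qed
  have main: "main_effects_unconfounded p q n G"
    unfolding main_effects_unconfounded_def
  proof
    fix e assume e: "e \<in> main_effects n"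
    then obtain i where i: "e = {i}" "i < n"
      unfolding main_effects_def by (auto simp: card_1_singleton_iff)
    obtain j where j: "j < n" "j \<noteq> i" using n2 that[of "if i = 0 then 1 else 0"] by auto
    have "\<not> cols_dependent (col_part p G) {i}"
      using cols_dependent_singleton[of i "col_part p G"] nz[OF i(2)] part[OF gen] i by auto
    moreover have "{i, j} \<in> two_factor_interactions n"
      using i j unfolding two_factor_interactions_def by auto
    then have "\<not> cols_dependent (row_part p q G) {i}"
      using rows cols_dependent_mono[of _ "{i}" "{i, j}"] by blast
    ultimately show "unconfounded p q n G e"
      using eff e i unfolding unconfounded_def confounded_with_columns_def confounded_with_rows_def
      by auto
  qed
  have compl: "card {e \<in> two_factor_interactions n. \<not> cols_dependent (col_part p G') e} =
    card (two_factor_interactions n)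
      - card {e \<in> two_factor_interactions n. cols_dependent (col_part p G') e}" for G' :: "'a mat"
  proof -
    have "{e \<in> two_factor_interactions n. \<not> cols_dependent (col_part p G') e} =
      two_factor_interactions n - {e \<in> two_factor_interactions n. cols_dependent (col_part p G') e}"
      by auto
    then show ?thesis using fin by (simp add: card_Diff_subset)
  qed
  have G: "num_unconfounded_2fi p q n G =
    card {e \<in> two_factor_interactions n. \<not> cols_dependent (col_part p G) e}"
    unfolding num_unconfounded_2fi_def unconfounded_def confounded_with_columns_def
      confounded_with_rows_def
    using eff rows by (intro arg_cong[of _ _ card]) auto
  have "num_unconfounded_2fi p q n G' \<le> num_unconfounded_2fi p q n G"
    if G': "array_generator p q n G'" "main_effects_unconfounded p q n G'" for G' :: "'a mat"
  proof -
    have "col (col_part p G') l \<noteq> 0\<^sub>v p" if l: "l < n" for l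
    proof -
      have "{l} \<in> main_effects n" using l by (auto simp: main_effects_def)
      then have "\<not> cols_dependent (col_part p G') {l}"
        using G'(2) unfolding main_effects_unconfounded_def unconfounded_def
          confounded_with_columns_def by blast
      then show ?thesis
        using cols_dependent_singleton[of l "col_part p G'"] part[OF G'(1)] l by auto
    qed
    then have "card {e \<in> two_factor_interactions n. cols_dependent (col_part p G) e}
      \<le> card {e \<in> two_factor_interactions n. cols_dependent (col_part p G') e}"
      by (intro dependent_pairs_minimal_if_balanced[of _ p _ _ k] part gen G' nz bal)
    moreover have "num_unconfounded_2fi p q n G' \<le>
      card {e \<in> two_factor_interactions n. \<not> cols_dependent (col_part p G') e}"
      unfolding num_unconfounded_2fi_def unconfounded_def confounded_with_columns_def
      using fin by (intro card_mono) auto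
    ultimately show ?thesis unfolding G compl by linarith
  qed
  then show ?thesis using gen main unfolding yields_2fi_optimal_def by blast
qed

section \<open>The generator matrix\<close>

definition design_mat :: "nat \<Rightarrow> nat \<Rightarrow> 'a::field mat \<Rightarrow> 'a mat" where
  "design_mat p q X =
    (1\<^sub>m p @\<^sub>c (ones_mat p + exchange_mat p) @\<^sub>c col_mat (ones_vec p) @\<^sub>c X)
    @\<^sub>r (exchange_mat p @\<^sub>c (ones_mat p + 2 \<cdot>\<^sub>m 1\<^sub>m p)
        @\<^sub>c col_mat (2 \<cdot>\<^sub>v ones_vec p + unit_vec p 0 - unit_vec p (p - 1)) @\<^sub>c 0\<^sub>m p (q - p))
    @\<^sub>r (0\<^sub>m (q - p) p @\<^sub>c 0\<^sub>m (q - p) p @\<^sub>c 0\<^sub>m (q - p) 1 @\<^sub>c 1\<^sub>m (q - p))"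

lemmas block_defs = append_cols_def append_rows_def col_mat_def ones_vec_def ones_mat_def
  exchange_mat_def

lemma sum_lessThan_add:
  fixes f :: "nat \<Rightarrow> 'a::comm_monoid_add"
  shows "(\<Sum>l<m + k. f l) = (\<Sum>l<m. f l) + (\<Sum>l<k. f (m + l))"
  by (induction k) (simp_all add: add.assoc)

context
  fixes p q n :: nat and X G :: "'a::field mat"
  assumes p3: "3 \<le> p" and pq: "p \<le> q" and n: "n = p + q + 1"
    and X: "X \<in> carrier_mat p (q - p)" and G: "G = design_mat p q X"
    and two: "(2 :: 'a) \<noteq> 0"
begin

text \<open>The entries of the vector \<open>b\<close> of the middle block, namely \<open>3, 2, \<dots>, 2, 1\<close>.\<close>

abbreviation "b_entry r \<equiv> (2 :: 'a) + (if r = 0 then 1 else 0) - (if r = p - 1 then 1 else 0)"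

lemma design_mat_carrier: "G \<in> carrier_mat (p + q) n"
  unfolding G design_mat_def block_defs using pq X n by auto

lemma top_entries:
  assumes "r < p"
  shows "k < p \<Longrightarrow> G $$ (r, k) = (if k = r then 1 else 0)"
    and "k < p \<Longrightarrow> G $$ (r, p + k) = 1 + (if k = p - 1 - r then 1 else 0)"
    and "G $$ (r, 2 * p) = 1"
    and "k < q - p \<Longrightarrow> G $$ (r, Suc (2 * p + k)) = X $$ (r, k)"
  unfolding G design_mat_def block_defs using assms p3 pq X by (auto simp: mat_of_cols_def)

lemma middle_entries:
  assumes "r < p"
  shows "k < p \<Longrightarrow> G $$ (p + r, k) = (if k = p - 1 - r then 1 else 0)"
    and "k < p \<Longrightarrow> G $$ (p + r, p + k) = 1 + (if k = r then 2 else 0)"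
    and "G $$ (p + r, 2 * p) = b_entry r"
    and "k < q - p \<Longrightarrow> G $$ (p + r, Suc (2 * p + k)) = 0"
  unfolding G design_mat_def block_defs using assms p3 pq X by (auto simp: mat_of_cols_def)

lemma bottom_entries:
  assumes "r < q - p"
  shows "k < p \<Longrightarrow> G $$ (2 * p + r, k) = 0"
    and "k < p \<Longrightarrow> G $$ (2 * p + r, p + k) = 0"
    and "G $$ (2 * p + r, 2 * p) = 0"
    and "k < q - p \<Longrightarrow> G $$ (2 * p + r, Suc (2 * p + k)) = (if k = r then 1 else 0)"
  unfolding G design_mat_def block_defs using assms p3 pq X by (auto simp: mat_of_cols_def)

lemma sum_blocks:
  fixes f :: "nat \<Rightarrow> 'a"
  shows "(\<Sum>l<n. f l) = (\<Sum>k<p. f k) + (\<Sum>k<p. f (p + k)) + f (2 * p)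
    + (\<Sum>k<q - p. f (Suc (2 * p + k)))"
proof -
  have "n = p + p + 1 + (q - p)" using n pq by simp
  then show ?thesis by (simp only: sum_lessThan_add mult_2) simp
qed

lemma top_row:
  assumes "r < p"
  shows "(\<Sum>l<n. c l * G $$ (r, l)) = c r + ((\<Sum>k<p. c (p + k)) + c (p + (p - 1 - r)))
    + c (2 * p) + (\<Sum>k<q - p. c (Suc (2 * p + k)) * X $$ (r, k))"
  using assms unfolding sum_blocks
  by (simp add: top_entries distrib_left sum.distrib if_distrib[of "(*) _"] del: add_Suc_right
      mult_2 flip: One_nat_def cong: if_cong)

lemma middle_row:
  assumes "r < p"
  shows "(\<Sum>l<n. c l * G $$ (p + r, l)) = c (p - 1 - r) + ((\<Sum>k<p. c (p + k)) + 2 * c (p + r))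
    + c (2 * p) * G $$ (p + r, 2 * p)"
  using assms unfolding sum_blocks
  by (simp add: middle_entries(1,2,4) distrib_left sum.distrib if_distrib[of "(*) _"] mult.commute[of _ "2 :: 'a"] cong: if_cong)

lemma bottom_row:
  assumes "r < q - p"
  shows "(\<Sum>l<n. c l * G $$ (2 * p + r, l)) = c (Suc (2 * p + r))"
  using assms unfolding sum_blocks
  by (simp add: bottom_entries if_distrib[of "(*) _"] cong: if_cong)

text \<open>The kernel of the generator matrix is the line through the vector that has entry \<open>1\<close> in column
  \<open>2 * p\<close>, entries \<open>-2, -1, \<dots>, -1, 0\<close> in the second block, \<open>p - 1, p, \<dots>, p, p + 1\<close> in the first
  block and \<open>0\<close> in the last one. As the exchange matrix \<open>H\<close> satisfies \<open>H * H = I\<close> and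
  \<open>H * J = J\<close>, multiplying the top rows by \<open>H\<close> and subtracting them from the middle rows leaves the
  second block of coefficients as \<open>c (2 * p)\<close> times \<open>a - b\<close>.\<close>

lemma kernel_vector:
  assumes ker: "\<And>r. r < p + q \<Longrightarrow> (\<Sum>l<n. c l * G $$ (r, l)) = 0"
  shows "r < p \<Longrightarrow> c r = c (2 * p) * (of_nat p - 2 + b_entry (p - 1 - r))"
    and "r < p \<Longrightarrow> c (p + r) = c (2 * p) * (1 - b_entry r)"
    and "r < q - p \<Longrightarrow> c (Suc (2 * p + r)) = 0"
proof -
  let ?T = "\<Sum>k<p. c (p + k)" and ?z = "c (2 * p)"
  have bottom: "c (Suc (2 * p + r)) = 0" if "r < q - p" for r
    using ker[of "2 * p + r"] bottom_row[OF that, of c] that by simp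
  have top: "c r + (?T + c (p + (p - 1 - r))) + ?z = 0" if "r < p" for r
    using ker[of r] top_row[OF that, of c] bottom that by simp
  have middle: "c (p - 1 - r) + (?T + 2 * c (p + r)) + ?z * b_entry r = 0" if "r < p" for r
    using ker[of "p + r"] middle_row[OF that, of c] middle_entries(3)[OF that] that pq by simp
  \<comment> \<open>Top row \<open>p - 1 - r\<close> and middle row \<open>r\<close> meet the same column of the first block.\<close>
  have y: "c (p + r) = ?z * (1 - b_entry r)" if r: "r < p" for r
  proof -
    have "p - 1 - (p - 1 - r) = r" "p - 1 - r < p" using r by auto
    then have "c (p - 1 - r) + (?T + c (p + r)) + ?z = 0" using top[of "p - 1 - r"] by simp
    then have "(c (p - 1 - r) + (?T + 2 * c (p + r)) + ?z * b_entry r)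
      - (c (p - 1 - r) + (?T + c (p + r)) + ?z) = 0"
      using middle[OF r] by simp
    then show ?thesis by (simp add: algebra_simps)
  qed
  have "(\<Sum>k<p. 1 - b_entry k) = - of_nat p"
    using p3 by (simp add: sum.distrib sum_subtractf algebra_simps)
  moreover have "?T = ?z * (\<Sum>k<p. 1 - b_entry k)"
    unfolding sum_distrib_left by (intro sum.cong refl y) simp
  ultimately have T: "?T = - of_nat p * ?z" by simp
  have x: "c r = ?z * (of_nat p - 2 + b_entry (p - 1 - r))" if r: "r < p" for r
  proof -
    have "c (p + (p - 1 - r)) = ?z * (1 - b_entry (p - 1 - r))" by (rule y) (use r in simp)
    then have "c r + (- of_nat p * ?z + ?z * (1 - b_entry (p - 1 - r))) + ?z = 0"
      using top[OF r] unfolding T by metis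
    then show ?thesis by (simp only: algebra_simps eq_neg_iff_add_eq_0) (simp add: algebra_simps)
  qed
  show "r < p \<Longrightarrow> c r = ?z * (of_nat p - 2 + b_entry (p - 1 - r))"
    "r < p \<Longrightarrow> c (p + r) = ?z * (1 - b_entry r)"
    "r < q - p \<Longrightarrow> c (Suc (2 * p + r)) = 0"
    by (fact x, fact y, fact bottom)
qed

lemma column_cases:
  assumes "l < n"
  obtains (x) "l < p" | (y) r where "r < p" "l = p + r" | (z) "l = 2 * p"
    | (w) r where "r < q - p" "l = Suc (2 * p + r)"
proof -
  consider "l < p" | "p \<le> l" "l < 2 * p" | "l = 2 * p" | "2 * p < l" by linarith
  then show thesis
  proof cases
    case 2
    then show thesis using y[of "l - p"] by simp
  next
    case 4
    then show thesis using w[of "l - Suc (2 * p)"] assms n by simp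
  qed (use x z in auto)
qed

lemma kernel_vector_eq_0:
  assumes ker: "\<And>r. r < p + q \<Longrightarrow> (\<Sum>l<n. c l * G $$ (r, l)) = 0"
    and z: "c (2 * p) = 0" and l: "l < n"
  shows "c l = 0"
  using l by (cases rule: column_cases) (simp_all add: kernel_vector[OF ker] z)

text \<open>Every nonzero vector of the kernel has at least five nonzero entries. Columns \<open>2 * p\<close> and
  \<open>p, \<dots>, 2 * p - 2\<close> carry \<open>p\<close> of them; in the first block the entries \<open>p - 1\<close> and \<open>p + 1\<close> differ by
  \<open>2\<close> and so are not both zero, which suffices for \<open>p \<ge> 4\<close>. For \<open>p = 3\<close> they are \<open>2\<close> and \<open>4\<close>, both
  nonzero.\<close>

lemma four_columns_independent:
  assumes S: "S \<subseteq> {..<n}" "card S \<le> 4"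
  shows "\<not> cols_dependent G S"
proof
  assume "cols_dependent G S"
  then obtain c where c: "\<exists>l<n. c l \<noteq> 0" and out: "\<And>l. l \<notin> S \<Longrightarrow> c l = 0"
    and "\<And>r. r < dim_row G \<Longrightarrow> (\<Sum>l<n. c l * G $$ (r, l)) = 0"
    using cols_dependent_coefficients S(1) by metis
  then have ker: "\<And>r. r < p + q \<Longrightarrow> (\<Sum>l<n. c l * G $$ (r, l)) = 0"
    using design_mat_carrier by auto
  have z: "c (2 * p) \<noteq> 0" using kernel_vector_eq_0[OF ker] c by blast
  have "c p = c (2 * p) * (- 2)" using kernel_vector(2)[OF ker, of 0] p3 by simp
  then have "c p \<noteq> 0" using z two by simp
  have y: "c (p + r) \<noteq> 0" if "0 < r" "r < p - 1" for r
    using kernel_vector(2)[OF ker, of r] that z by simp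
  have x0: "c 0 = c (2 * p) * (of_nat p - 1)"
    using kernel_vector(1)[OF ker, of 0] p3 by simp
  have x1: "c (p - 1) = c (2 * p) * (of_nat p + 1)"
    using kernel_vector(1)[OF ker, of "p - 1"] p3 by simp
  have "\<exists>U. card U = 5 \<and> (\<forall>l\<in>U. c l \<noteq> 0)"
  proof (cases "p = 3")
    case True
    have "c 0 = c (2 * p) * 2" "c (p - 1) = c (2 * p) * (2 * 2)"
      using x0 x1 True by simp_all
    then have "c 0 \<noteq> 0" "c (p - 1) \<noteq> 0" using z two by (metis mult_eq_0_iff)+
    moreover have "card {2 * p, p, p + 1, 0, p - 1} = 5" using True by simp
    ultimately show ?thesis
      using z \<open>c p \<noteq> 0\<close> y[of 1] True by (intro exI[of _ "{2 * p, p, p + 1, 0, p - 1}"]) auto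
  next
    case False
    have "c 0 \<noteq> 0 \<or> c (p - 1) \<noteq> 0"
    proof (rule ccontr)
      assume "\<not> (c 0 \<noteq> 0 \<or> c (p - 1) \<noteq> 0)"
      then have "of_nat p - 1 = (0 :: 'a)" "of_nat p + 1 = (0 :: 'a)" using x0 x1 z by auto
      then have "(2 :: 'a) = 0" by (metis add_diff_cancel_left' diff_diff_eq2 diff_zero one_add_one diff_add_cancel)
      then show False using two by simp
    qed
    then obtain x where "x = 0 \<or> x = p - 1" "c x \<noteq> 0" by blast
    then have x: "x < p" "c x \<noteq> 0" using p3 by auto
    have "card {2 * p, p, p + 1, p + 2, x} = 5" using False p3 x(1) by simp
    then show ?thesis
      using z \<open>c p \<noteq> 0\<close> y[of 1] y[of 2] False p3 x(2)
      by (intro exI[of _ "{2 * p, p, p + 1, p + 2, x}"]) auto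
  qed
  then obtain U where U: "card U = 5" "\<forall>l\<in>U. c l \<noteq> 0" by blast
  then have "U \<subseteq> S" using out by blast
  moreover have "finite S" using S(1) finite_subset by blast
  ultimately have "5 \<le> card S" using U(1) card_mono by metis
  then show False using S(2) by simp
qed

text \<open>A kernel vector that vanishes in column \<open>2 * p\<close> is zero, so the other \<open>p + q\<close> columns are
  independent.\<close>

lemma design_mat_array_generator: "array_generator p q n G"
proof -
  have "\<not> cols_dependent G ({..<n} - {2 * p})"
  proof
    assume "cols_dependent G ({..<n} - {2 * p})"
    then show False
    proof (rule cols_dependent_coefficients[OF _ Diff_subset])
      fix c :: "nat \<Rightarrow> 'a"
      assume c: "\<exists>l<n. c l \<noteq> 0" and out: "\<And>l. l \<notin> {..<n} - {2 * p} \<Longrightarrow> c l = 0"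
        and ker: "\<And>r. r < dim_row G \<Longrightarrow> (\<Sum>l<n. c l * G $$ (r, l)) = 0"
      have "c l = 0" if "l < n" for l
        by (rule kernel_vector_eq_0) (use ker out that design_mat_carrier in simp_all)
      then show False using c by blast
    qed
  qed
  then have "vec_space.rank (p + q) G = p + q"
    using pq n by (intro rank_eq_dim_row[OF design_mat_carrier, of "{..<n} - {2 * p}"]) auto
  then show ?thesis
    unfolding array_generator_def using p3 pq n design_mat_carrier by simp
qed

text \<open>In the row part, a coefficient in one of the first two blocks enters, apart from the common sum
  over the second block, only one of the \<open>p \<ge> 3\<close> middle rows. With two nonzero coefficients at least
  one middle row, and two if column \<open>2 * p\<close> is involved, contain only that common sum and a
  multiple of the entry of \<open>b\<close>. Since the entries of \<open>b\<close> in rows \<open>0\<close>, \<open>1\<close> and \<open>p - 1\<close> are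
  \<open>3, 2, 1\<close>, with nonzero differences, column \<open>2 * p\<close> has coefficient \<open>0\<close> and then the common sum
  is \<open>0\<close>. Now middle row \<open>r\<close> pairs each nonzero coefficient of the second block with a nonzero one
  of the first, so the second block has at most one; but the sum over it is \<open>0\<close>.\<close>

lemma row_part_pair_independent:
  assumes e: "e \<in> two_factor_interactions n"
  shows "\<not> cols_dependent (row_part p q G) e"
proof
  assume dep: "cols_dependent (row_part p q G) e"
  obtain i j where ij: "e = {i, j}" "i \<noteq> j" "i < n" "j < n"
    using e unfolding two_factor_interactions_def card_2_iff by auto
  obtain c where c: "\<exists>l<n. c l \<noteq> 0" and out: "\<And>l. l \<notin> {i, j} \<Longrightarrow> c l = 0"
    and "\<And>r. r < dim_row (row_part p q G) \<Longrightarrow> (\<Sum>l<n. c l * row_part p q G $$ (r, l)) = 0"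
    using cols_dependent_coefficients[OF dep, of n] ij by auto
  then have ker: "(\<Sum>l<n. c l * G $$ (p + r, l)) = 0" if "r < q" for r
    using that design_mat_carrier by (simp add: row_part_def)
  let ?T = "\<Sum>k<p. c (p + k)" and ?z = "c (2 * p)"
  have bottom: "c (Suc (2 * p + r)) = 0" if "r < q - p" for r
    using ker[of "p + r"] bottom_row[OF that, of c] that by (simp add: mult_2 add.assoc)
  have middle: "c (p - 1 - r) + (?T + 2 * c (p + r)) + ?z * b_entry r = 0" if "r < p" for r
    using ker[of r] middle_row[OF that, of c] middle_entries(3)[OF that] that pq by simp
  \<comment> \<open>The middle row in which column \<open>l\<close> of the first two blocks differs from all other rows.\<close>
  define row_of where "row_of l = (if l < p then p - 1 - l else l - p)" for l
  have row_of: "p - 1 - r \<noteq> l" "p + r \<noteq> l" if "r < p" "r \<noteq> row_of l" for r l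
    using that by (auto simp: row_of_def)
  have z: "?z = 0"
  proof (rule ccontr)
    assume "?z \<noteq> 0"
    then have "2 * p \<in> {i, j}" using out by blast
    then obtain o' where o': "{i, j} = {2 * p, o'}" by blast
    have T: "?T + ?z * b_entry r = 0" if "r < p" "r \<noteq> row_of o'" for r
    proof -
      have "p - 1 - r \<notin> {i, j}" "p + r \<notin> {i, j}"
        unfolding o' using row_of[OF that] that by auto
      then show ?thesis using middle[OF that(1)] out by simp
    qed
    have *: "?z * (b_entry r - b_entry r') = 0"
      if "r < p" "r' < p" "r \<noteq> row_of o'" "r' \<noteq> row_of o'" for r r'
    proof -
      have "?T + ?z * b_entry r = ?T + ?z * b_entry r'" using T[of r] T[of r'] that by metis
      then show ?thesis by (simp only: right_diff_distrib add_left_cancel right_minus_eq)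
    qed
    have "p - 1 \<noteq> 1" "p - 1 \<noteq> 0" using p3 by auto
    then have b: "b_entry 0 - b_entry 1 = 1" "b_entry 0 - b_entry (p - 1) = 2"
      "b_entry 1 - b_entry (p - 1) = 1"
      by simp_all
    consider "row_of o' = 0" | "row_of o' = 1" | "row_of o' \<noteq> 0" "row_of o' \<noteq> 1" by blast
    then have "?z = 0"
      by cases (use *[of 1 "p - 1", unfolded b] *[of 0 "p - 1", unfolded b] *[of 0 1, unfolded b]
        p3 two in simp_all)
    then show False using \<open>?z \<noteq> 0\<close> by simp
  qed
  have T: "?T = 0"
  proof -
    have "\<exists>r\<in>{0, 1, 2}. r \<noteq> row_of i \<and> r \<noteq> row_of j" by auto
    then obtain r where "r \<in> {0, 1, 2}" and r: "r \<noteq> row_of i" "r \<noteq> row_of j" by blast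
    then have "r < p" using p3 by auto
    then have "c (p - 1 - r) = 0" "c (p + r) = 0" using row_of[OF _ r(1)] row_of[OF _ r(2)] out by auto
    then show ?thesis using middle[OF \<open>r < p\<close>] z by simp
  qed
  have y: "c (p + r) = 0" if r: "r < p" for r
  proof (rule ccontr)
    assume nz: "c (p + r) \<noteq> 0"
    have "c (p - 1 - r) = - (2 * c (p + r))"
      using middle[OF r] z T by (simp add: eq_neg_iff_add_eq_0)
    then have "c (p - 1 - r) \<noteq> 0" using nz two by simp
    \<comment> \<open>Both nonzero coefficients are now located, and only one of them is in the second block.\<close>
    then have "p + r \<in> {i, j}" "p - 1 - r \<in> {i, j}" using nz out by blast+
    moreover have "p + r \<noteq> p - 1 - r" using r by linarith
    ultimately have "{i, j} = {p + r, p - 1 - r}" by auto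
    then have "c (p + k) = (if k = r then c (p + r) else 0)" if "k < p" for k
      using out that r by auto
    then have "?T = (\<Sum>k<p. if k = r then c (p + r) else 0)" by (intro sum.cong) auto
    also have "\<dots> = c (p + r)" using r by simp
    finally show False using T nz by simp
  qed
  have x: "c r = 0" if "r < p" for r
  proof -
    have "p - 1 - (p - 1 - r) = r" "p - 1 - r < p" using that by auto
    then show ?thesis using middle[of "p - 1 - r"] y[of "p - 1 - r"] z T by simp
  qed
  have "c l = 0" if "l < n" for l
    using that by (cases rule: column_cases) (simp_all add: x y z bottom)
  then show False using c by blast
qed

lemma col_part_design_mat:
  "col_part p G = 1\<^sub>m p @\<^sub>c (ones_mat p + exchange_mat p) @\<^sub>c col_mat (ones_vec p) @\<^sub>c X"
  unfolding G design_mat_def col_part_def block_defs using X pq by (intro eq_matI) auto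

lemma col_part_nonzero:
  assumes X0: "\<And>k. k < q - p \<Longrightarrow> col X k \<noteq> 0\<^sub>v p" and l: "l < n"
  shows "col (col_part p G) l \<noteq> 0\<^sub>v p"
proof
  assume eq: "col (col_part p G) l = 0\<^sub>v p"
  have zero: "G $$ (r, l) = 0" if "r < p" for r
  proof -
    have "col (col_part p G) l $ r = G $$ (r, l)"
      using l that design_mat_carrier by (simp add: col_part_def)
    then show ?thesis using eq that by simp
  qed
  show False
    using l
  proof (cases rule: column_cases)
    case x
    then show False using zero[of l] top_entries(1)[of l l] by simp
  next
    case (y r)
    then show False
      using zero[of "p - 1 - r"] top_entries(2)[of "p - 1 - r" r] two by simp
  next
    case z
    then show False using zero[of 0] top_entries(3)[of 0] p3 by simp
  next
    case (w k)
    then have "X $$ (r, k) = 0" if "r < p" for r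
      using zero[OF that] top_entries(4)[OF that, of k] by simp
    then have "col X k = 0\<^sub>v p" using X w(1) by (intro eq_vecI) auto
    then show False using X0 w(1) by blast
  qed
qed

end

lemma two_neq_0_mod_ring:
  assumes "odd CARD('s::prime_card)"
  shows "(2 :: 's mod_ring) \<noteq> 0"
proof
  assume "(2 :: 's mod_ring) = 0"
  then have "CARD('s) dvd 2" using of_nat_0_mod_ring_dvd[of 2, where 'a = 's] by simp
  then have "CARD('s) = 2" using prime_card[where 'a = 's] primes_dvd_imp_eq two_is_prime_nat by blast
  then show False using assms by simp
qed

theorem theorem11:
  fixes s p q n \<alpha> :: nat
    and a b :: "'s::prime_card mod_ring vec"
    and X Gtop G :: "'s mod_ring mat"
  assumes "s = CARD('s)" and "odd s"
    and "3 \<le> p" and "p \<le> q" and "n = p + q + 1"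
    and "a = ones_vec p"
    and "b = 2 \<cdot>\<^sub>v a + unit_vec p 0 - unit_vec p (p - 1)"
    and "X \<in> carrier_mat p (q - p)"
    and "\<forall>j<q - p. col X j \<noteq> 0\<^sub>v p"
    and "Gtop = 1\<^sub>m p @\<^sub>c (ones_mat p + exchange_mat p) @\<^sub>c col_mat a @\<^sub>c X"
    and "\<alpha> = nat \<lfloor>real (n * (s - 1)) / real (s ^ p - 1)\<rfloor>"
    and "\<forall>P \<in> pg_points p. appearances Gtop P = \<alpha> \<or> appearances Gtop P = \<alpha> + 1"
    and "G =
      Gtop
      @\<^sub>r (exchange_mat p @\<^sub>c (ones_mat p + 2 \<cdot>\<^sub>m 1\<^sub>m p) @\<^sub>c col_mat b @\<^sub>c 0\<^sub>m p (q - p))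
      @\<^sub>r (0\<^sub>m (q - p) p @\<^sub>c 0\<^sub>m (q - p) p @\<^sub>c 0\<^sub>m (q - p) 1 @\<^sub>c 1\<^sub>m (q - p))"
  shows "yields_2fi_optimal p q n G"
proof -
  have G: "G = design_mat p q X"
    unfolding design_mat_def assms(13,10,7,6) ..
  have two: "(2 :: 's mod_ring) \<noteq> 0" using two_neq_0_mod_ring assms(1,2) by blast
  note hyps = assms(3,4,5,8) G two
  have top: "col_part p G = Gtop"
    using col_part_design_mat[OF hyps] assms(6,10) by simp
  show ?thesis
  proof (rule optimal_if_balanced[where k = \<alpha>])
    show "array_generator p q n G" by (rule design_mat_array_generator[OF hyps])
    show "\<not> cols_dependent G S" if "S \<subseteq> {..<n}" "card S \<le> 4" for S
      using that by (rule four_columns_independent[OF hyps])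
    show "col (col_part p G) l \<noteq> 0\<^sub>v p" if "l < n" for l
      using assms(9) that by (intro col_part_nonzero[OF hyps]) auto
    show "\<not> cols_dependent (row_part p q G) e" if "e \<in> two_factor_interactions n" for e
      using that by (rule row_part_pair_independent[OF hyps])
    show "appearances (col_part p G) P = \<alpha> \<or> appearances (col_part p G) P = \<alpha> + 1"
      if "P \<in> pg_points p" for P
      using assms(12) that unfolding top by blast
  qed
qed

end
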